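(* $$\sum_{r=1}^\infty \frac{H_{r,2}^2}{r^2}=\frac{19}{22680}\pi^6+\zeta(3)^2 .$$
   Context: For a positive integer $N$, $H_{N,m}=\sum_{r=1}^N \frac{1}{r^m}$ is the generalized harmonic number of order $m$; $H_{r,2}^2$ denotes $(H_{r,2})^2$. $\zeta(m)=\sum_{r=1}^\infty r^{-m}$ is the Riemann zeta function. *)

theory Defs
  imports "HOL-Analysis.Analysis"
begin

definition gen_harm :: "nat \<Rightarrow> nat \<Rightarrow> real" where
  "gen_harm N m = (\<Sum>r=1..N. 1 / real r ^ m)"

(* The Riemann zeta function at natural numbers m \<ge> 2, where the series converges. *)
definition zeta :: "nat \<Rightarrow> real" where
  "zeta m = (\<Sum>r. 1 / real (Suc r) ^ m)"

end

(* Write H_r for H_{r,2} and zeta(a,b) for the sum of n^(-a) m^(-b) over n > m >= 1. Telescoping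
   H_r^3 - H_{r-1}^3 = 3 H_r^2/r^2 - 3 H_r/r^4 + 1/r^6 reduces the claim to zeta(2), zeta(6) and the
   sum of H_r/r^4, which is zeta(4,2) + zeta(6). Expanding zeta(3)^2 and zeta(2) zeta(4) in two ways,
   by comparing the two summation indices (stuffle) and by partial fractions in m and m + k
   (shuffle), gives zeta(4,2) = zeta(3)^2 - 4/3 zeta(6). Finally zeta(4) and zeta(6) come from
   zeta(2) = pi^2/6 through the telescoping sum of 1/(m^2 - n^2) over all m distinct from n, which
   is 3/(4n^2). *)

theory Submission
  imports Defs "HOL-Real_Asymp.Real_Asymp"
begin

section \<open>Double zeta values and sums over pairs of positive integers\<close>

definition below_pairs :: "(nat \<times> nat) set" where
  "below_pairs = (SIGMA n:{1..}. {1..<n})"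

text \<open>An infinite sum of a non-summable family defaults to 0, so this is known to be zeta(a,b)
  only for exponents covered by \<open>double_zeta_has_sum\<close>.\<close>

definition double_zeta :: "nat \<Rightarrow> nat \<Rightarrow> real" where
  "double_zeta a b = (\<Sum>\<^sub>\<infinity>(n, m)\<in>below_pairs. 1 / (real n ^ a * real m ^ b))"

lemma has_sum_from_1_iff:
  "(f has_sum s) {1::nat..} \<longleftrightarrow> ((\<lambda>n. f (Suc n)) has_sum s) UNIV"
  by (rule has_sum_reindex_bij_witness[of _ Suc "\<lambda>n. n - 1"]) auto

lemma zeta_has_sum:
  assumes "k \<ge> 2"
  shows "((\<lambda>n. 1 / real n ^ k) has_sum zeta k) {1..}"
proof -
  have "summable (\<lambda>n. inverse (real n ^ k))"
    using inverse_power_summable[OF assms, where 'a = real] by simp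
  then have "summable (\<lambda>n. 1 / real (Suc n) ^ k)"
    by (subst summable_Suc_iff) (simp add: inverse_eq_divide)
  then show ?thesis
    unfolding has_sum_from_1_iff zeta_def
    by (intro sums_nonneg_imp_has_sum summable_sums) auto
qed

lemma zeta_product_has_sum:
  assumes "a \<ge> 2" "b \<ge> 2"
  shows "((\<lambda>(n, m). 1 / (real n ^ a * real m ^ b)) has_sum zeta a * zeta b) ({1..} \<times> {1..})"
proof -
  note Za = zeta_has_sum[OF assms(1)] and Zb = zeta_has_sum[OF assms(2)]
  have *: "((\<lambda>m. 1 / (real n ^ a * real m ^ b)) has_sum 1 / real n ^ a * zeta b) {1..}" for n :: nat
    using has_sum_cmult_right[OF Zb, of "1 / real n ^ a"] by simp
  have **: "((\<lambda>n. 1 / real n ^ a * zeta b) has_sum zeta a * zeta b) {1..}"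
    by (rule has_sum_cmult_left[OF Za])
  have "(\<lambda>(n, m). 1 / (real n ^ a * real m ^ b)) summable_on ({1..} \<times> {1..})"
    by (rule summable_on_SigmaI[OF _ has_sum_imp_summable[OF **]]) (use * in auto)
  with * ** show ?thesis
    by (intro has_sum_SigmaI) auto
qed

text \<open>The substitution n = m + k makes m and k independent, as both the shuffle product and
  the bound by powers of n - m require.\<close>

lemma bij_betw_add_below_pairs:
  "bij_betw (\<lambda>(m, k). (m + k, m)) ({1..} \<times> {1..}) below_pairs"
  by (rule bij_betwI[where g = "\<lambda>(n, m). (m, n - m)"]) (auto simp: below_pairs_def)

lemma swap_below_pairs: "prod.swap ` below_pairs = (SIGMA n:{1..}. {n<..})"
  by (force simp: below_pairs_def image_iff)

text \<open>Trichotomy of the two indices, with the part n < m carried back to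
  \<open>below_pairs\<close> by a swap. No sign condition on \<open>f\<close> is imposed, so it also
  serves for terms with denominator m^2 - n^2.\<close>

lemma has_sum_positive_pairs:
  fixes f :: "nat \<times> nat \<Rightarrow> real"
  assumes "(f has_sum s) below_pairs" "((\<lambda>(n, m). f (m, n)) has_sum t) below_pairs"
    and "((\<lambda>n. f (n, n)) has_sum u) {1..}"
  shows "(f has_sum s + t + u) ({1..} \<times> {1..})"
proof -
  have t: "(f has_sum t) (prod.swap ` below_pairs)"
    using assms(2) by (subst has_sum_reindex) (auto simp: o_def prod.swap_def case_prod_unfold)
  have u: "(f has_sum u) ((\<lambda>n. (n, n)) ` {1..})"
    using assms(3) by (subst has_sum_reindex) (auto simp: o_def inj_on_def)
  have st: "(f has_sum s + t) (below_pairs \<union> prod.swap ` below_pairs)"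
    by (rule has_sum_Un_disjoint[OF assms(1) t])
       (auto simp: swap_below_pairs, auto simp: below_pairs_def)
  have "(f has_sum s + t + u)
      ((below_pairs \<union> prod.swap ` below_pairs) \<union> (\<lambda>n. (n, n)) ` {1..})"
    by (rule has_sum_Un_disjoint[OF st u])
       (auto simp: swap_below_pairs, auto simp: below_pairs_def)
  also have "(below_pairs \<union> prod.swap ` below_pairs) \<union> (\<lambda>n. (n, n)) ` {1..} = {1..} \<times> {1..}"
    unfolding swap_below_pairs by (auto simp: below_pairs_def image_iff)
  finally show ?thesis .
qed

text \<open>Comparison with 1/(n^2 m^2): since m < n, a surplus power of n makes up for a missing
  power of m. This admits \<open>b = 1\<close>, as in zeta(5,1).\<close>

lemma double_zeta_has_sum:
  assumes "a \<ge> 2" "b \<ge> 1" "a + b \<ge> 4"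
  shows "((\<lambda>(n, m). 1 / (real n ^ a * real m ^ b)) has_sum double_zeta a b) below_pairs"
proof -
  have "(\<lambda>(n, m). 1 / (real n ^ 2 * real m ^ 2)) summable_on ({1..} \<times> {1..})"
    using zeta_product_has_sum[of 2 2] by (auto simp: summable_on_def)
  then have *: "(\<lambda>(n, m). 1 / (real n ^ 2 * real m ^ 2)) summable_on below_pairs"
    by (rule summable_on_subset) (auto simp: below_pairs_def)
  have le: "real n ^ 2 * real m ^ 2 \<le> real n ^ a * real m ^ b" if "1 \<le> m" "m < n" for n m :: nat
  proof -
    define a' b' where "a' = a - 2" and "b' = b - 1"
    then have ab: "a = 2 + a'" "b = 1 + b'" "1 \<le> a' + b'"
      using assms by auto
    have "real m ^ 1 \<le> real m ^ (a' + b')"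
      using that ab by (intro power_increasing) auto
    also have "\<dots> \<le> real n ^ a' * real m ^ b'"
      using that by (simp add: power_add mult_right_mono power_mono)
    finally have "real n ^ 2 * real m * real m \<le> real n ^ 2 * real m * (real n ^ a' * real m ^ b')"
      by (intro mult_left_mono) auto
    then show ?thesis
      by (simp add: ab power_add power2_eq_square mult_ac)
  qed
  have "(\<lambda>(n, m). 1 / (real n ^ a * real m ^ b)) summable_on below_pairs"
    by (rule summable_on_comparison_test[OF *])
       (auto simp: below_pairs_def intro!: divide_left_mono le)
  then show ?thesis
    unfolding double_zeta_def by (rule has_sum_infsum)
qed

text \<open>The stuffle product: the diagonal of the double series contributes
  \<open>zeta (a + b)\<close>.\<close>

lemma zeta_mult_zeta:
  assumes "a \<ge> 2" "b \<ge> 2"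
  shows "zeta a * zeta b = double_zeta a b + double_zeta b a + zeta (a + b)"
proof (rule has_sum_unique[OF zeta_product_has_sum[OF assms]])
  show "((\<lambda>(n, m). 1 / (real n ^ a * real m ^ b)) has_sum
      double_zeta a b + double_zeta b a + zeta (a + b)) ({1..} \<times> {1..})"
    using double_zeta_has_sum[of a b] double_zeta_has_sum[of b a] zeta_has_sum[of "a + b"] assms
    by (intro has_sum_positive_pairs) (auto simp: mult.commute power_add)
qed

section \<open>Shuffle products by partial fractions\<close>

text \<open>Partial fractions produce powers of m and of k next to powers of m + k; exchanging m and
  k shows that both kinds have the same sum.\<close>

lemma double_zeta_has_sum_add:
  assumes "a \<ge> 2" "b \<ge> 1" "a + b \<ge> 4"
  shows "((\<lambda>(m, k). 1 / (real (m + k) ^ a * real m ^ b)) has_sum double_zeta a b) ({1..} \<times> {1..})"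
    and "((\<lambda>(m, k). 1 / (real (m + k) ^ a * real k ^ b)) has_sum double_zeta a b) ({1..} \<times> {1..})"
proof -
  show *: "((\<lambda>(m, k). 1 / (real (m + k) ^ a * real m ^ b)) has_sum double_zeta a b) ({1..} \<times> {1..})"
    using has_sum_reindex_bij_betw[OF bij_betw_add_below_pairs] double_zeta_has_sum[OF assms]
    by (smt (verit) case_prod_unfold has_sum_cong prod.sel)
  then show "((\<lambda>(m, k). 1 / (real (m + k) ^ a * real k ^ b)) has_sum double_zeta a b) ({1..} \<times> {1..})"
    by (subst (asm) has_sum_swap) (simp add: add.commute)
qed

lemma zeta_3_squared_shuffle:
  "zeta 3 * zeta 3 = 2 * double_zeta 3 3 + 6 * double_zeta 4 2 + 12 * double_zeta 5 1"
proof -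
  \<comment> \<open>Partial fractions of 1/(x^a y^b): the coefficient of 1/((x+y)^i y^j), where i +
    j = a + b, is binomial(i-1, a-1), and that of 1/((x+y)^i x^j) is binomial(i-1, b-1). For a = b =
    3 these are 1, 3, 6.\<close>
  have id: "1 / (x ^ 3 * y ^ 3) =
      (1 / ((x + y) ^ 3 * x ^ 3) + 1 / ((x + y) ^ 3 * y ^ 3))
      + 3 * (1 / ((x + y) ^ 4 * x ^ 2) + 1 / ((x + y) ^ 4 * y ^ 2))
      + 6 * (1 / ((x + y) ^ 5 * x ^ 1) + 1 / ((x + y) ^ 5 * y ^ 1))"
    if "x > 0" "y > 0" for x y :: real
  proof -
    have "x + y \<noteq> 0" using that by simp
    then show ?thesis using that by (simp add: divide_simps) algebra
  qed
  \<comment> \<open>Each summand keeps its own case expression, so that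
    \<open>double_zeta_has_sum_add\<close> applies to it directly; \<open>id\<close> then merges
    them pointwise.\<close>
  have "((\<lambda>p. (case p of (m, k) \<Rightarrow> 1 / (real (m + k) ^ 3 * real m ^ 3))
        + (case p of (m, k) \<Rightarrow> 1 / (real (m + k) ^ 3 * real k ^ 3))
      + 3 * ((case p of (m, k) \<Rightarrow> 1 / (real (m + k) ^ 4 * real m ^ 2))
        + (case p of (m, k) \<Rightarrow> 1 / (real (m + k) ^ 4 * real k ^ 2)))
      + 6 * ((case p of (m, k) \<Rightarrow> 1 / (real (m + k) ^ 5 * real m ^ 1))
        + (case p of (m, k) \<Rightarrow> 1 / (real (m + k) ^ 5 * real k ^ 1)))) has_sum
      (double_zeta 3 3 + double_zeta 3 3 + 3 * (double_zeta 4 2 + double_zeta 4 2)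
        + 6 * (double_zeta 5 1 + double_zeta 5 1))) ({1..} \<times> {1..})"
    by (intro has_sum_add has_sum_cmult_right double_zeta_has_sum_add) auto
  also have "?this \<longleftrightarrow> ((\<lambda>(m, k). 1 / (real m ^ 3 * real k ^ 3)) has_sum
      (double_zeta 3 3 + double_zeta 3 3 + 3 * (double_zeta 4 2 + double_zeta 4 2)
        + 6 * (double_zeta 5 1 + double_zeta 5 1))) ({1..} \<times> {1..})"
    using id[of "real (fst p)" "real (snd p)" for p]
    by (intro has_sum_cong) (simp add: case_prod_unfold mem_Times_iff)
  finally show ?thesis
    using has_sum_unique[OF zeta_product_has_sum[of 3 3]] by simp
qed

lemma zeta_2_zeta_4_shuffle:
  "zeta 2 * zeta 4 =
    double_zeta 2 4 + 2 * double_zeta 3 3 + 4 * double_zeta 4 2 + 8 * double_zeta 5 1"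
proof -
  \<comment> \<open>The same decomposition with a = 2 and b = 4: coefficients 1, 2, 3, 4 on the y
    side and 1, 4 on the x side.\<close>
  have id: "1 / (x ^ 2 * y ^ 4) =
      1 / ((x + y) ^ 2 * y ^ 4) + 2 * (1 / ((x + y) ^ 3 * y ^ 3))
      + (1 / ((x + y) ^ 4 * x ^ 2) + 3 * (1 / ((x + y) ^ 4 * y ^ 2)))
      + 4 * (1 / ((x + y) ^ 5 * x ^ 1) + 1 / ((x + y) ^ 5 * y ^ 1))"
    if "x > 0" "y > 0" for x y :: real
  proof -
    have "x + y \<noteq> 0" using that by simp
    then show ?thesis using that by (simp add: divide_simps) algebra
  qed
  have "((\<lambda>p. (case p of (m, k) \<Rightarrow> 1 / (real (m + k) ^ 2 * real k ^ 4))
        + 2 * (case p of (m, k) \<Rightarrow> 1 / (real (m + k) ^ 3 * real k ^ 3))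
      + ((case p of (m, k) \<Rightarrow> 1 / (real (m + k) ^ 4 * real m ^ 2))
        + 3 * (case p of (m, k) \<Rightarrow> 1 / (real (m + k) ^ 4 * real k ^ 2)))
      + 4 * ((case p of (m, k) \<Rightarrow> 1 / (real (m + k) ^ 5 * real m ^ 1))
        + (case p of (m, k) \<Rightarrow> 1 / (real (m + k) ^ 5 * real k ^ 1)))) has_sum
      (double_zeta 2 4 + 2 * double_zeta 3 3 + (double_zeta 4 2 + 3 * double_zeta 4 2)
        + 4 * (double_zeta 5 1 + double_zeta 5 1))) ({1..} \<times> {1..})"
    by (intro has_sum_add has_sum_cmult_right double_zeta_has_sum_add) auto
  also have "?this \<longleftrightarrow> ((\<lambda>(m, k). 1 / (real m ^ 2 * real k ^ 4)) has_sum
      (double_zeta 2 4 + 2 * double_zeta 3 3 + (double_zeta 4 2 + 3 * double_zeta 4 2)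
        + 4 * (double_zeta 5 1 + double_zeta 5 1))) ({1..} \<times> {1..})"
    using id[of "real (fst p)" "real (snd p)" for p]
    by (intro has_sum_cong) (simp add: case_prod_unfold mem_Times_iff)
  finally show ?thesis
    using has_sum_unique[OF zeta_product_has_sum[of 2 4]] by simp
qed

text \<open>Linear elimination: \<open>double_zeta 2 4\<close> cancels between the two expansions of
  \<open>zeta 2 * zeta 4\<close>, and the two of \<open>zeta 3 * zeta 3\<close> determine
  \<open>double_zeta 3 3\<close> and \<open>double_zeta 5 1\<close> in terms of the rest.\<close>

lemma double_zeta_4_2: "double_zeta 4 2 = (zeta 3)\<^sup>2 - 4 / 3 * zeta 6"
  using zeta_mult_zeta[of 3 3] zeta_mult_zeta[of 2 4]
    zeta_3_squared_shuffle zeta_2_zeta_4_shuffle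
  by (simp add: power2_eq_square)

section \<open>The series of 1/(m^2 - n^2)\<close>

lemma sums_diff_shift:
  fixes u :: "nat \<Rightarrow> real"
  assumes "u \<longlonglongrightarrow> 0"
  shows "(\<lambda>m. u m - u (m + N)) sums (\<Sum>i<N. u i)"
proof (induction N)
  case 0
  show ?case by simp
next
  case (Suc N)
  have "(\<lambda>m. u (m + N)) \<longlonglongrightarrow> 0"
    using assms by (rule LIMSEQ_ignore_initial_segment)
  \<comment> \<open>Enlarging the shift by one adds an ordinary telescoping series with sum
    \<open>u N\<close>.\<close>
  from sums_add[OF Suc telescope_sums'[OF this]] show ?case
    by simp
qed

lemma sum_inverse_symmetric:
  "n \<ge> 1 \<Longrightarrow> (\<Sum>i<2 * n. 1 / (real (Suc i) - real n)) = 1 / real n"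
proof -
  assume "n \<ge> 1"
  define g where "g = (\<lambda>j. 1 / (real j - real n))"
  \<comment> \<open>The reflection j -> 2n - j changes the sign of \<open>g\<close>, and
    \<open>g n\<close> is 1/0 = 0, so only j = 2n survives.\<close>
  have "(\<Sum>j\<in>{1..2 * n - 1}. g j) = (\<Sum>j\<in>{1..2 * n - 1}. - g j)"
    by (rule sum.reindex_bij_witness[of _ "\<lambda>j. 2 * n - j" "\<lambda>j. 2 * n - j"])
       (auto simp: g_def of_nat_diff minus_divide_right)
  then have 0: "(\<Sum>j\<in>{1..2 * n - 1}. g j) = 0"
    by (simp add: sum_negf)
  have "(\<Sum>i<2 * n. 1 / (real (Suc i) - real n)) = (\<Sum>j\<in>{1..2 * n}. g j)"
    unfolding g_def by (rule sum.reindex_bij_witness[of _ "\<lambda>j. j - 1" Suc]) auto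
  also have "{1..2 * n} = insert (2 * n) {1..2 * n - 1}"
    using \<open>n \<ge> 1\<close> by auto
  also have "(\<Sum>j\<in>\<dots>. g j) = g (2 * n)"
    using 0 \<open>n \<ge> 1\<close> by (subst sum.insert) auto
  finally show ?thesis by (simp add: g_def)
qed

text \<open>The term with \<open>m = n\<close> is \<open>1 / 0 = 0\<close>, so it does not contribute.\<close>

lemma sums_inverse_square_diff:
  assumes "n \<ge> 1"
  shows "(\<lambda>i. 1 / (real (Suc i) ^ 2 - real n ^ 2)) sums (3 / (4 * real n ^ 2))"
proof -
  \<comment> \<open>Partial fractions: 1/(x^2 - n^2) is 1/(2n) times 1/(x - n) - 1/(x + n), and the
    second fraction is the first shifted by 2n.\<close>
  define u where "u i = 1 / (real (Suc i) - real n)" for i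
  have "u \<longlonglongrightarrow> 0"
    unfolding u_def by real_asymp
  from sums_diff_shift[OF this, of "2 * n"]
  have "(\<lambda>i. u i - u (i + 2 * n)) sums (1 / real n)"
    using sum_inverse_symmetric[OF assms] by (simp add: u_def)
  then have "(\<lambda>i. 1 / (2 * real n) * (u i - u (i + 2 * n))) sums (1 / (2 * real n) * (1 / real n))"
    by (rule sums_mult)
  \<comment> \<open>At i = n - 1 we have \<open>u i = 0\<close> but
    \<open>u (i + 2 * n) = 1 / (2 * real n)\<close>, so the telescoping term is -1/(4n^2); adding
    1/(4n^2) there restores the value 0.\<close>
  from sums_add[OF this sums_single[of "n - 1" "\<lambda>_. 1 / (4 * real n ^ 2)"]]
  have "(\<lambda>i. 1 / (2 * real n) * (u i - u (i + 2 * n)) + (if i = n - 1 then 1 / (4 * real n ^ 2) else 0))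
      sums (1 / (2 * real n) * (1 / real n) + 1 / (4 * real n ^ 2))" .
  also have "(\<lambda>i. 1 / (2 * real n) * (u i - u (i + 2 * n)) + (if i = n - 1 then 1 / (4 * real n ^ 2) else 0))
      = (\<lambda>i. 1 / (real (Suc i) ^ 2 - real n ^ 2))"
  proof
    fix i
    show "1 / (2 * real n) * (u i - u (i + 2 * n)) + (if i = n - 1 then 1 / (4 * real n ^ 2) else 0)
      = 1 / (real (Suc i) ^ 2 - real n ^ 2)"
    proof (cases "i = n - 1")
      case True
      then have "real (Suc i) = real n" using assms by simp
      then show ?thesis
        using True assms by (simp add: u_def power2_eq_square divide_simps)
    next
      case False
      define x where "x = real (Suc i)"
      have x: "x \<noteq> real n" "x > 0" using False assms by (auto simp: x_def simp del: of_nat_Suc)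
      have n: "real n > 0" using assms by simp
      have "u i = 1 / (x - real n)" "u (i + 2 * n) = 1 / (x + real n)"
        by (simp_all add: u_def x_def algebra_simps)
      moreover have "x ^ 2 - real n ^ 2 = (x - real n) * (x + real n)"
        by (simp add: power2_eq_square algebra_simps)
      moreover have "x - real n \<noteq> 0" "x + real n \<noteq> 0" using x n by auto
      ultimately have "1 / (2 * real n) * (u i - u (i + 2 * n)) = 1 / (x ^ 2 - real n ^ 2)"
        using n by (simp only:) (simp add: divide_simps)
      then show ?thesis
        using False by (simp add: x_def)
    qed
  qed
  also have "1 / (2 * real n) * (1 / real n) + 1 / (4 * real n ^ 2) = 3 / (4 * real n ^ 2)"
    by (simp add: power2_eq_square divide_simps)
  finally show ?thesis .
qed

text \<open>For m < n, n^2 - m^2 is at least (n - m)^2, so 1/(m^2 d^2) with d = n - m dominates both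
  families. This unconditional summability justifies the rearrangement of the double series.\<close>

lemma inverse_square_diff_summable:
  assumes "k \<ge> 2"
  shows "(\<lambda>(n, m). 1 / (real n ^ k * (real m ^ 2 - real n ^ 2))) summable_on below_pairs"
    and "(\<lambda>(n, m). 1 / (real m ^ k * (real n ^ 2 - real m ^ 2))) summable_on below_pairs"
proof -
  have "(\<lambda>(m, d). 1 / (real m ^ 2 * real d ^ 2)) summable_on ({1..} \<times> {1..})"
    using zeta_product_has_sum[of 2 2] by (auto simp: summable_on_def)
  also have "?this \<longleftrightarrow> (\<lambda>(n, m). 1 / (real m ^ 2 * real (n - m) ^ 2)) summable_on below_pairs"
    by (subst summable_on_reindex_bij_betw[OF bij_betw_add_below_pairs, symmetric])
       (simp add: case_prod_unfold)
  finally have *: "(\<lambda>(n, m). 1 / (real m ^ 2 * real (n - m) ^ 2)) summable_on below_pairs" .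
  \<comment> \<open>The index \<open>l\<close> stands for either n or m and so handles both families
    at once.\<close>
  have le: "real m ^ 2 * real (n - m) ^ 2 \<le> real l ^ k * (real n ^ 2 - real m ^ 2)"
    and pos: "0 < real l ^ k * (real n ^ 2 - real m ^ 2)"
    if "1 \<le> m" "m < n" "m \<le> l" for n m l :: nat
  proof -
    have "real m ^ 2 \<le> real l ^ 2" using that by (intro power_mono) auto
    also have "\<dots> \<le> real l ^ k" using that assms by (intro power_increasing) auto
    finally have 1: "real m ^ 2 \<le> real l ^ k" .
    have 2: "real (n - m) ^ 2 \<le> real n ^ 2 - real m ^ 2"
      using that by (simp add: of_nat_diff power2_eq_square algebra_simps mult_left_mono)
    show "real m ^ 2 * real (n - m) ^ 2 \<le> real l ^ k * (real n ^ 2 - real m ^ 2)"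
      using 1 2 by (intro mult_mono) auto
    have "0 < real m ^ 2 * real (n - m) ^ 2" using that by simp
    with \<open>real m ^ 2 * real (n - m) ^ 2 \<le> real l ^ k * (real n ^ 2 - real m ^ 2)\<close>
    show "0 < real l ^ k * (real n ^ 2 - real m ^ 2)" by linarith
  qed
  have dom: "(\<lambda>(n, m). 1 / (real (g (n, m)) ^ k * (real n ^ 2 - real m ^ 2))) summable_on below_pairs"
    if "\<And>n m. m < n \<Longrightarrow> m \<le> g (n, m)" for g
    by (rule summable_on_comparison_test[OF *])
       (use that pos in \<open>auto simp: below_pairs_def less_imp_le intro!: divide_left_mono le\<close>)
  show "(\<lambda>(n, m). 1 / (real m ^ k * (real n ^ 2 - real m ^ 2))) summable_on below_pairs"
    using dom[of snd] by simp
  have "(\<lambda>(n, m). - (1 / (real n ^ k * (real n ^ 2 - real m ^ 2)))) summable_on below_pairs"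
    using dom[of fst] by (subst summable_on_uminus[symmetric]) (simp add: case_prod_unfold)
  then show "(\<lambda>(n, m). 1 / (real n ^ k * (real m ^ 2 - real n ^ 2))) summable_on below_pairs"
    by (simp add: minus_divide_right flip: mult_minus_right)
qed

text \<open>Both sides are the sum of \<open>1 / (n ^ k * (m\<^sup>2 - n\<^sup>2))\<close> over all positive pairs: once
  symmetrised, once row by row.\<close>

lemma has_sum_symmetrised_square_diff:
  assumes "k \<ge> 2"
  shows "((\<lambda>(n, m). 1 / (real n ^ k * (real m ^ 2 - real n ^ 2))
      + 1 / (real m ^ k * (real n ^ 2 - real m ^ 2))) has_sum 3 / 4 * zeta (k + 2)) below_pairs"
proof -
  define h where "h = (\<lambda>(n, m). 1 / (real n ^ k * (real m ^ 2 - real n ^ 2)))"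
  obtain s t where s: "(h has_sum s) below_pairs"
    and t: "((\<lambda>(n, m). h (m, n)) has_sum t) below_pairs"
    using inverse_square_diff_summable[OF assms] by (auto simp: summable_on_def h_def)
  \<comment> \<open>The diagonal contributes 0 because \<open>h (n, n)\<close> is a division by
    zero.\<close>
  have st: "(h has_sum s + t) ({1..} \<times> {1..})"
    using has_sum_positive_pairs[OF s t, of 0] by (simp add: h_def)
  have row: "((\<lambda>m. h (n, m)) has_sum 3 / 4 * (1 / real n ^ (k + 2))) {1..}" if "n \<in> {1..}" for n
  proof -
    \<comment> \<open>Telescoping evaluates the row only as an ordered series; unordered
      summability, inherited from the product, identifies that value with the row sum.\<close>
    have "(\<lambda>m. h (n, m)) summable_on {1..}"
      using summable_on_SigmaD1[of "curry h" "{1..}" "\<lambda>_. {1..}" n]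
        has_sum_imp_summable[OF st] that by (simp add: curry_def)
    then obtain r where r: "((\<lambda>m. h (n, m)) has_sum r) {1..}"
      by (auto simp: summable_on_def)
    then have "(\<lambda>i. h (n, Suc i)) sums r"
      unfolding has_sum_from_1_iff by (rule has_sum_imp_sums)
    moreover have "(\<lambda>i. h (n, Suc i)) sums (1 / real n ^ k * (3 / (4 * real n ^ 2)))"
      using sums_mult[OF sums_inverse_square_diff, of n "1 / real n ^ k"] that by (simp add: h_def)
    ultimately have "r = 1 / real n ^ k * (3 / (4 * real n ^ 2))"
      by (rule sums_unique2)
    then show ?thesis
      using r by (simp add: power_add power2_eq_square mult_ac)
  qed
  have "((\<lambda>n. 3 / 4 * (1 / real n ^ (k + 2))) has_sum s + t) {1..}"
    by (rule has_sum_SigmaD[OF st row])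
  moreover have "((\<lambda>n. 3 / 4 * (1 / real n ^ (k + 2))) has_sum 3 / 4 * zeta (k + 2)) {1..}"
    by (intro has_sum_cmult_right zeta_has_sum) auto
  ultimately have "s + t = 3 / 4 * zeta (k + 2)"
    by (rule has_sum_unique)
  with has_sum_add[OF s t] show ?thesis
    by (simp add: h_def case_prod_unfold)
qed

section \<open>\<open>zeta 6\<close> as a multiple of the cube of \<open>zeta 2\<close>\<close>

text \<open>For k = 2 the symmetrised term has numerator y^2 - x^2 over x^2 y^2 (y^2 - x^2), and the
  difference cancels.\<close>

lemma double_zeta_2_2: "double_zeta 2 2 = 3 / 4 * zeta 4"
proof -
  have "1 / (x ^ 2 * (y ^ 2 - x ^ 2)) + 1 / (y ^ 2 * (x ^ 2 - y ^ 2)) = 1 / (x ^ 2 * y ^ 2)"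
    if "0 < y" "y < x" for x y :: real
  proof -
    have "x ^ 2 - y ^ 2 \<noteq> 0" "y ^ 2 - x ^ 2 \<noteq> 0" "x \<noteq> 0" "y \<noteq> 0"
      using that power_strict_mono[of y x 2] by auto
    then show ?thesis by (simp add: divide_simps) algebra
  qed
  then have "((\<lambda>(n, m). 1 / (real n ^ 2 * real m ^ 2)) has_sum 3 / 4 * zeta (2 + 2)) below_pairs"
    using has_sum_symmetrised_square_diff[of 2]
    by (subst has_sum_cong[of _ _ "\<lambda>(n, m). 1 / (real n ^ 2 * (real m ^ 2 - real n ^ 2))
      + 1 / (real m ^ 2 * (real n ^ 2 - real m ^ 2))"]) (auto simp: below_pairs_def)
  then show ?thesis
    using has_sum_unique[OF double_zeta_has_sum[of 2 2]] by simp
qed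

text \<open>For k = 4 the numerator is y^4 - x^4; dividing by y^2 - x^2 leaves x^2 + y^2, hence two
  double zeta terms.\<close>

lemma double_zeta_2_4_plus_4_2: "double_zeta 2 4 + double_zeta 4 2 = 3 / 4 * zeta 6"
proof -
  have id: "1 / (x ^ 4 * (y ^ 2 - x ^ 2)) + 1 / (y ^ 4 * (x ^ 2 - y ^ 2))
      = 1 / (x ^ 2 * y ^ 4) + 1 / (x ^ 4 * y ^ 2)"
    if "0 < y" "y < x" for x y :: real
  proof -
    have "x ^ 2 - y ^ 2 \<noteq> 0" "y ^ 2 - x ^ 2 \<noteq> 0" "x \<noteq> 0" "y \<noteq> 0"
      using that power_strict_mono[of y x 2] by auto
    then show ?thesis by (simp add: divide_simps) algebra
  qed
  have "((\<lambda>(n, m). 1 / (real n ^ 2 * real m ^ 4) + 1 / (real n ^ 4 * real m ^ 2))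
      has_sum 3 / 4 * zeta (4 + 2)) below_pairs"
    using has_sum_symmetrised_square_diff[of 4]
    by (subst has_sum_cong[of _ _ "\<lambda>(n, m). 1 / (real n ^ 4 * (real m ^ 2 - real n ^ 2))
      + 1 / (real m ^ 4 * (real n ^ 2 - real m ^ 2))"]) (auto simp: below_pairs_def id)
  moreover have "((\<lambda>(n, m). 1 / (real n ^ 2 * real m ^ 4) + 1 / (real n ^ 4 * real m ^ 2))
      has_sum double_zeta 2 4 + double_zeta 4 2) below_pairs"
    using has_sum_add[OF double_zeta_has_sum[of 2 4] double_zeta_has_sum[of 4 2]]
    by (simp add: case_prod_unfold)
  ultimately show ?thesis
    using has_sum_unique by fastforce
qed

lemma zeta_2: "zeta 2 = pi\<^sup>2 / 6"
  using inverse_squares_sums by (simp add: zeta_def sums_iff add.commute)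

lemma zeta_6: "zeta 6 = pi ^ 6 / 945"
proof -
  \<comment> \<open>Stuffle gives \<open>zeta 2 * zeta 2\<close> = (2 * 3/4 + 1)
    \<open>zeta 4\<close> and \<open>zeta 2 * zeta 4\<close> = (3/4 + 1)
    \<open>zeta 6\<close>.\<close>
  have "zeta 4 = 2 / 5 * zeta 2 * zeta 2" "zeta 6 = 4 / 7 * zeta 2 * zeta 4"
    using zeta_mult_zeta[of 2 2] zeta_mult_zeta[of 2 4] double_zeta_2_2 double_zeta_2_4_plus_4_2
    by simp_all
  then have "zeta 6 = 8 / 35 * zeta 2 ^ 3"
    by (simp only: power3_eq_cube)
  then show ?thesis
    by (simp add: zeta_2 power_divide flip: power_mult)
qed

section \<open>Sums with harmonic numbers\<close>

lemma sums_gen_harm_2_over_4: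
  "(\<lambda>r. gen_harm (Suc r) 2 / real (Suc r) ^ 4) sums (double_zeta 4 2 + zeta 6)"
proof -
  define g where "g = (\<lambda>n. \<Sum>m\<in>{1..<n}. 1 / (real n ^ 4 * real m ^ 2))"
  have "(g has_sum double_zeta 4 2) {1..}"
    using double_zeta_has_sum[of 4 2] unfolding below_pairs_def g_def
    by (rule has_sum_SigmaD) (auto intro!: has_sum_finiteI)
  then have "((\<lambda>n. g n + 1 / real n ^ 6) has_sum double_zeta 4 2 + zeta 6) {1..}"
    by (intro has_sum_add zeta_has_sum) auto
  then have "(\<lambda>r. g (Suc r) + 1 / real (Suc r) ^ 6) sums (double_zeta 4 2 + zeta 6)"
    unfolding has_sum_from_1_iff by (rule has_sum_imp_sums)
  moreover have "g (Suc r) + 1 / real (Suc r) ^ 6 = gen_harm (Suc r) 2 / real (Suc r) ^ 4" for r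
  proof -
    \<comment> \<open>The last term of the harmonic number is the diagonal and yields
      \<open>zeta 6\<close>; the others are the row of \<open>double_zeta 4 2\<close>.\<close>
    have "gen_harm (Suc r) 2 = (\<Sum>m\<in>{1..<Suc r}. 1 / real m ^ 2) + 1 / real (Suc r) ^ 2"
      by (simp add: gen_harm_def atLeastLessThanSuc_atLeastAtMost)
    then show ?thesis
      by (simp add: g_def sum_divide_distrib add_divide_distrib mult.commute
          del: of_nat_Suc flip: power_add)
  qed
  ultimately show ?thesis by simp
qed

theorem mainTheorem2:
  shows "(\<lambda>r. (gen_harm (Suc r) 2)\<^sup>2 / real (Suc r) ^ 2) sums
           (19 / 22680 * pi ^ 6 + (zeta 3)\<^sup>2)"
proof -
  let ?H = "\<lambda>n. gen_harm n 2"
  have H_Suc: "?H (Suc r) = ?H r + 1 / real (Suc r) ^ 2" for r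
    by (simp add: gen_harm_def)
  have zsums: "(\<lambda>r. 1 / real (Suc r) ^ k) sums zeta k" if "k \<ge> 2" for k
    using zeta_has_sum[OF that] unfolding has_sum_from_1_iff by (rule has_sum_imp_sums)
  have "?H n = (\<Sum>r<n. 1 / real (Suc r) ^ 2)" for n
    by (induction n) (simp_all add: H_Suc, simp add: gen_harm_def)
  then have "?H \<longlonglongrightarrow> zeta 2"
    using zsums[of 2] by (simp add: sums_def)
  then have "(\<lambda>n. ?H n ^ 3) \<longlonglongrightarrow> zeta 2 ^ 3"
    by (rule tendsto_power)
  \<comment> \<open>The lower end of the telescope vanishes because \<open>gen_harm 0 2\<close> is
    an empty sum.\<close>
  from telescope_sums[OF this]
  have cube: "(\<lambda>r. ?H (Suc r) ^ 3 - ?H r ^ 3) sums (zeta 2 ^ 3)"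
    by (simp add: gen_harm_def)
  have "(?H (Suc r) ^ 3 - ?H r ^ 3 - 1 / real (Suc r) ^ 6) * (1 / 3)
      + ?H (Suc r) / real (Suc r) ^ 4 = ?H (Suc r) ^ 2 / real (Suc r) ^ 2" for r
  proof -
    define x where "x = 1 / real (Suc r) ^ 2"
    have x: "1 / real (Suc r) ^ 6 = x ^ 3" "?H (Suc r) / real (Suc r) ^ 4 = ?H (Suc r) * x ^ 2"
      "?H (Suc r) ^ 2 / real (Suc r) ^ 2 = ?H (Suc r) ^ 2 * x" "?H r = ?H (Suc r) - x"
      using H_Suc[of r] by (simp_all add: x_def power_divide flip: power_mult)
    show ?thesis
      unfolding x by (simp add: power2_eq_square power3_eq_cube algebra_simps)
  qed
  moreover have "(\<lambda>r. (?H (Suc r) ^ 3 - ?H r ^ 3 - 1 / real (Suc r) ^ 6) * (1 / 3)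
      + ?H (Suc r) / real (Suc r) ^ 4) sums
      ((zeta 2 ^ 3 - zeta 6) * (1 / 3) + (double_zeta 4 2 + zeta 6))"
    by (intro sums_add sums_mult2 sums_diff cube zsums sums_gen_harm_2_over_4) auto
  \<comment> \<open>The coefficient of \<open>zeta 6\<close> is -1/3 - 4/3 + 1 = -2/3, and 1/648 -
    2/2835 = 19/22680.\<close>
  moreover have "(zeta 2 ^ 3 - zeta 6) * (1 / 3) + (double_zeta 4 2 + zeta 6)
      = 19 / 22680 * pi ^ 6 + (zeta 3)\<^sup>2"
    by (simp add: double_zeta_4_2 zeta_2 zeta_6 power_divide flip: power_mult)
  ultimately show ?thesis by simp
qed

end
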